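(* Let $G$ be a simple game with $n$ players and let $N=(n+1)2^{\frac{1}{2}n\log_2 n}$. Then $G$ is a weighted majority game if and only if $G$ is $N$-trade robust.
   Context: A simple game is a pair $G=(P,W)$ with $P$ a finite set of $n$ players (e.g. $P=[n]$) and $W\subseteq 2^P$ (the winning coalitions) such that $X\in W$ and $X\subseteq Y\subseteq P$ imply $Y\in W$, and $W$ is non-trivial ($W\neq\emptyset$ and $W\ne 2^P$). Coalitions not in $W$ are losing; $L=2^P\setminus W$. $G$ is a weighted majority game if there are non-negative reals $w_1,\dots,w_n$ and a real $q>0$ such that $X\in W$ iff $\sum_{i\in X}w_i\ge q$. A sequence of coalitions $(X_1,\dots,X_j;Y_1,\dots,Y_j)$ is a trading transform if for every player $a$, $|\{i: a\in X_i\}|=|\{i:a\in Y_i\}|$. $G$ is $k$-trade robust if there is no trading transform $(X_1,\dots,X_j;Y_1,\dots,Y_j)$ with $j\le k$ in which all $X_i$ are winning and all $Y_i$ are losing. *)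

theory Defs
  imports Complex_Main
begin

definition simple_game :: "'a set \<Rightarrow> 'a set set \<Rightarrow> bool" where
  "simple_game P W \<longleftrightarrow>
     finite P \<and> W \<subseteq> Pow P \<and>
     (\<forall>X Y. X \<in> W \<and> X \<subseteq> Y \<and> Y \<subseteq> P \<longrightarrow> Y \<in> W) \<and>
     W \<noteq> {} \<and> W \<noteq> Pow P"

definition losing :: "'a set \<Rightarrow> 'a set set \<Rightarrow> 'a set set" where
  "losing P W = Pow P - W"

definition weighted_majority_game :: "'a set \<Rightarrow> 'a set set \<Rightarrow> bool" where
  "weighted_majority_game P W \<longleftrightarrow>
     (\<exists>(w :: 'a \<Rightarrow> real) q. (\<forall>i\<in>P. 0 \<le> w i) \<and> 0 < q \<and>
        (\<forall>X. X \<subseteq> P \<longrightarrow> (X \<in> W \<longleftrightarrow> q \<le> (\<Sum>i\<in>X. w i))))"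

text \<open>
  The two lists are the two halves of the sequence. They have to be non-empty:
  otherwise the empty transform would consist vacuously of winning and losing
  coalitions, and no game would be trade robust.
\<close>

definition trading_transform :: "'a set \<Rightarrow> 'a set list \<Rightarrow> 'a set list \<Rightarrow> bool" where
  "trading_transform P Xs Ys \<longleftrightarrow>
     Xs \<noteq> [] \<and> length Xs = length Ys \<and>
     set Xs \<subseteq> Pow P \<and> set Ys \<subseteq> Pow P \<and>
     (\<forall>a\<in>P. card {i. i < length Xs \<and> a \<in> Xs ! i} = card {i. i < length Ys \<and> a \<in> Ys ! i})"

text \<open>
  The bound is real because \<open>(n + 1) * 2 powr (n * log 2 n / 2)\<close> need not be an integer.
\<close>

definition trade_robust :: "real \<Rightarrow> 'a set \<Rightarrow> 'a set set \<Rightarrow> bool" where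
  "trade_robust k P W \<longleftrightarrow>
     \<not> (\<exists>Xs Ys. trading_transform P Xs Ys \<and> real (length Xs) \<le> k \<and>
          set Xs \<subseteq> W \<and> set Ys \<subseteq> losing P W)"

end

theory Submission
  imports Defs "Jordan_Normal_Form.Determinant"
begin

text \<open>
  A game is weighted iff some linear functional is positive on all differences \<open>1\<^sub>X - 1\<^sub>Y\<close> of a
  winning and a losing coalition. If there is none, Gordan's theorem yields a nontrivial nonnegative
  linear dependence between these vectors. In one of minimal support, all vectors but one are linearly
  independent; completing them by unit vectors to a basis and applying Cramer's rule, the coefficients
  become integers, namely absolute values of \<open>n \<times> n\<close> determinants with entries in \<open>{-1, 0, 1}\<close>.
  Hadamard's inequality bounds each of them by \<open>n powr (n / 2)\<close>, and at most \<open>n + 1\<close> of them occur.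
  Repeating each pair of coalitions as often as its coefficient says gives the trading transform.
\<close>

section \<open>Matrices given by their columns, and Cramer's rule\<close>

text \<open>\<open>B k\<close> is the column with index \<open>k\<close>. Vectors are functions of
  which only the values below \<open>n\<close> matter, so replacing a column is the function update
  \<open>B(k := v)\<close>.\<close>

definition cols_mat :: "nat \<Rightarrow> (nat \<Rightarrow> nat \<Rightarrow> real) \<Rightarrow> real mat" where
  "cols_mat n B = mat n n (\<lambda>(i, k). B k i)"

lemma cols_mat_carrier [simp]: "cols_mat n B \<in> carrier_mat n n"
  by (simp add: cols_mat_def)

lemma cols_mat_mult_vec:
  assumes "x \<in> carrier_vec n" and "i < n"
  shows "(cols_mat n B *\<^sub>v x) $ i = (\<Sum>k<n. x $ k * B k i)"
  using assms
  by (auto simp: cols_mat_def scalar_prod_def lessThan_atLeast0 mult.commute intro!: sum.cong)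

text \<open>Cramer's rule. It serves twice: to see that an exchange of basis vectors keeps the
  determinant nonzero, and to read coefficients of a linear relation as quotients of
  determinants.\<close>

lemma det_replace_column:
  assumes v: "\<And>i. i < n \<Longrightarrow> v i = (\<Sum>k<n. x k * B k i)" and k: "k < n"
  shows "det (cols_mat n (B(k := v))) = x k * det (cols_mat n B)"
proof -
  have "cols_mat n (B(k := v)) = replace_col (cols_mat n B) (cols_mat n B *\<^sub>v vec n x) k"
    using v cols_mat_mult_vec[of "vec n x" n _ B]
    by (intro eq_matI) (auto simp: cols_mat_def replace_col_def)
  then show ?thesis
    using cramer_lemma_mat[of "cols_mat n B" n "vec n x" k] k by simp
qed

lemma solve_columns:
  assumes "det (cols_mat n B) \<noteq> 0"
  shows "\<exists>x. \<forall>i<n. v i = (\<Sum>k<n. x k * B k i)"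
proof -
  let ?A = "cols_mat n B"
  have A: "?A \<in> carrier_mat n n" by simp
  obtain C where C: "C \<in> carrier_mat n n" "?A * C = 1\<^sub>m n"
    using det_non_zero_imp_unit[OF A assms, of "()"]
    by (auto simp: Units_def ring_mat_def)
  let ?x = "C *\<^sub>v vec n v"
  have x: "?x \<in> carrier_vec n" using C by simp
  have "?A *\<^sub>v ?x = (?A * C) *\<^sub>v vec n v"
    using assoc_mult_mat_vec[OF A C(1), of "vec n v"] by simp
  also have "\<dots> = vec n v" using C by simp
  finally have *: "?A *\<^sub>v ?x = vec n v" .
  have "v i = (\<Sum>k<n. (?x $ k) * B k i)" if "i < n" for i
    using cols_mat_mult_vec[OF x that, of B] * that by simp
  then show ?thesis by blast
qed

definition unit_fun :: "nat \<Rightarrow> nat \<Rightarrow> real" where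
  "unit_fun k i = (if i = k then 1 else 0)"

lemma sum_unit_fun:
  assumes "i < n"
  shows "(\<Sum>k<n. unit_fun i k * f k) = f i"
proof -
  have "(\<Sum>k<n. unit_fun i k * f k) = (\<Sum>k<n. if k = i then f k else 0)"
    by (intro sum.cong) (auto simp: unit_fun_def)
  then show ?thesis using assms by (simp add: sum.delta)
qed

lemma unit_fun_quadratic_form:
  assumes "i < n"
  shows "(\<Sum>k<n. \<Sum>j<n. unit_fun i k * M k j * unit_fun i j) = M i i"
proof -
  have "(\<Sum>k<n. \<Sum>j<n. unit_fun i k * M k j * unit_fun i j)
    = (\<Sum>k<n. unit_fun i k * (\<Sum>j<n. unit_fun i j * M k j))"
    by (simp add: sum_distrib_left mult_ac)
  then show ?thesis using assms by (simp add: sum_unit_fun)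
qed

lemma cols_mat_unit_fun: "cols_mat n unit_fun = 1\<^sub>m n"
  by (rule eq_matI) (auto simp: cols_mat_def unit_fun_def)

lemma det_cols_mat_Ints:
  assumes "\<And>k i. k < n \<Longrightarrow> i < n \<Longrightarrow> B k i \<in> \<int>"
  shows "det (cols_mat n B) \<in> \<int>"
proof -
  have "(\<Prod>i = 0..<n. cols_mat n B $$ (i, p i)) \<in> \<int>" if "p permutes {0..<n}" for p
    using that assms permutes_in_image[OF that]
    by (intro Ints_prod) (auto simp: cols_mat_def)
  then show ?thesis
    unfolding det_def'[OF cols_mat_carrier]
    by (intro Ints_sum Ints_mult) (auto simp: sign_def)
qed

section \<open>Hadamard's inequality\<close>

text \<open>One step of Gaussian elimination on columns: multiplication by the unipotent block
  matrix \<open>?U\<close> clears the rest of the first row and leaves the Schur complement of the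
  pivot in the lower right block.\<close>

lemma det_first_pivot:
  fixes G :: "nat \<Rightarrow> nat \<Rightarrow> real"
  assumes a: "G 0 0 \<noteq> 0"
  shows "det (mat (Suc n) (Suc n) (\<lambda>(i, j). G i j)) =
    G 0 0 * det (mat n n (\<lambda>(i, j). G (Suc i) (Suc j) - G (Suc i) 0 * G 0 (Suc j) / G 0 0))"
proof -
  let ?a = "mat 1 1 (\<lambda>_. G 0 0)" and ?r = "mat 1 n (\<lambda>(_, j). G 0 (Suc j))"
    and ?c = "mat n 1 (\<lambda>(i, _). G (Suc i) 0)" and ?D = "mat n n (\<lambda>(i, j). G (Suc i) (Suc j))"
    and ?u = "mat 1 n (\<lambda>(_, j). - G 0 (Suc j) / G 0 0)"
    and ?S = "mat n n (\<lambda>(i, j). G (Suc i) (Suc j) - G (Suc i) 0 * G 0 (Suc j) / G 0 0)"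
  let ?G = "mat (Suc n) (Suc n) (\<lambda>(i, j). G i j)"
  let ?U = "four_block_mat (1\<^sub>m 1) ?u (0\<^sub>m n 1) (1\<^sub>m n)"
  have G: "?G = four_block_mat ?a ?r ?c ?D"
    by (rule eq_matI) auto
  have "?G * ?U = four_block_mat (?a * 1\<^sub>m 1 + ?r * 0\<^sub>m n 1) (?a * ?u + ?r * 1\<^sub>m n)
      (?c * 1\<^sub>m 1 + ?D * 0\<^sub>m n 1) (?c * ?u + ?D * 1\<^sub>m n)"
    unfolding G by (rule mult_four_block_mat) auto
  also have "\<dots> = four_block_mat ?a (0\<^sub>m 1 n) ?c ?S"
  proof -
    have "?a * ?u + ?r * 1\<^sub>m n = 0\<^sub>m 1 n"
      using a by (intro eq_matI) (auto simp: scalar_prod_def)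
    moreover have "?c * ?u + ?D * 1\<^sub>m n = ?S"
      by (intro eq_matI) (auto simp: scalar_prod_def)
    moreover have "?a * 1\<^sub>m 1 + ?r * 0\<^sub>m n 1 = ?a"
      by (intro eq_matI) (auto simp: scalar_prod_def)
    moreover have "?c * 1\<^sub>m 1 + ?D * 0\<^sub>m n 1 = ?c"
      by (intro eq_matI) (auto simp: scalar_prod_def)
    ultimately show ?thesis by simp
  qed
  finally have "det (?G * ?U) = det ?a * det ?S"
    using det_four_block_mat_upper_right_zero[of ?a 1 "0\<^sub>m 1 n" n ?c ?S] by simp
  moreover have "det ?U = det (1\<^sub>m 1 :: real mat) * det (1\<^sub>m n :: real mat)"
    by (rule det_four_block_mat_lower_left_zero) auto
  moreover have "det (?G * ?U) = det ?G * det ?U"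
    by (rule det_mult[of _ "Suc n"]) auto
  moreover have "det ?a = G 0 0"
    by (simp add: det_single)
  ultimately show ?thesis by simp
qed

text \<open>Induction on the size. With a positive pivot, the Schur complement is again positive
  semidefinite, and subtracting the rank-one term can only lower its diagonal. With a zero pivot,
  semidefiniteness forces the first row to vanish, and so does the determinant.\<close>

lemma psd_det_le_prod_diag:
  fixes G :: "nat \<Rightarrow> nat \<Rightarrow> real"
  assumes sym: "\<And>i j. i < n \<Longrightarrow> j < n \<Longrightarrow> G i j = G j i"
    and psd: "\<And>x. 0 \<le> (\<Sum>i<n. \<Sum>j<n. x i * G i j * x j)"
  shows "det (mat n n (\<lambda>(i, j). G i j)) \<le> (\<Prod>i<n. G i i)"
  using assms
proof (induction n arbitrary: G)
  case 0
  then show ?case by simp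
next
  case (Suc n)
  have diag: "0 \<le> G i i" if "i < Suc n" for i
    using Suc.prems(2)[of "unit_fun i"] unit_fun_quadratic_form[OF that, of G] by simp
  \<comment> \<open>This is the quadratic form at the vector with coordinate \<open>t\<close> in
    front of \<open>x\<close>, sorted by powers of \<open>t\<close>.\<close>
  have quad: "0 \<le> t\<^sup>2 * G 0 0 + 2 * t * (\<Sum>i<n. x i * G 0 (Suc i))
      + (\<Sum>i<n. \<Sum>j<n. x i * G (Suc i) (Suc j) * x j)" for t x
  proof -
    let ?b = "\<Sum>i<n. x i * G 0 (Suc i)"
    have "(\<Sum>i<n. t * (x i * G (Suc i) 0)) = (\<Sum>i<n. t * (x i * G 0 (Suc i)))"
      using Suc.prems(1) by (intro sum.cong) auto
    then have "0 \<le> t\<^sup>2 * G 0 0 + (t * ?b + t * ?b)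
        + (\<Sum>i<n. \<Sum>j<n. x i * G (Suc i) (Suc j) * x j)"
      using Suc.prems(2)[of "\<lambda>i. case i of 0 \<Rightarrow> t | Suc i \<Rightarrow> x i"]
      by (simp add: sum.lessThan_Suc_shift sum.distrib power2_eq_square sum_distrib_left
          sum_distrib_right algebra_simps del: sum.lessThan_Suc)
    then show ?thesis by (simp add: algebra_simps)
  qed
  show ?case
  proof (cases "G 0 0 = 0")
    case True
    have "G 0 (Suc i) = 0" if "i < n" for i
    proof (rule ccontr)
      assume b: "G 0 (Suc i) \<noteq> 0"
      let ?g = "G (Suc i) (Suc i)"
      have "0 \<le> 2 * t * G 0 (Suc i) + ?g" for t
        using quad[of t "unit_fun i"] True sum_unit_fun[OF that, of "\<lambda>k. G 0 (Suc k)"]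
          unit_fun_quadratic_form[OF that, of "\<lambda>k j. G (Suc k) (Suc j)"] by simp
      \<comment> \<open>For this \<open>t\<close> the expression, which is affine in
        \<open>t\<close>, takes the value -1.\<close>
      from this[of "- (?g + 1) / (2 * G 0 (Suc i))"] show False
        using b by (simp add: field_simps)
    qed
    then have row: "G 0 j = 0" if "j < Suc n" for j
      using True that by (cases j) auto
    have "det (mat (Suc n) (Suc n) (\<lambda>(i, j). G i j)) = 0"
    proof -
      \<comment> \<open>Every product in the Leibniz formula contains a factor from the vanishing
        row 0.\<close>
      have "(\<Prod>i = 0..<Suc n. mat (Suc n) (Suc n) (\<lambda>(i, j). G i j) $$ (i, p i)) = 0"
        if "p permutes {0..<Suc n}" for p
      proof -
        have "p 0 < Suc n" using permutes_in_image[OF that, of 0] by simp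
        then show ?thesis
          using row by (intro prod_zero) (auto intro!: bexI[of _ 0])
      qed
      then show ?thesis
        by (subst det_def'[of _ "Suc n"]) (auto intro!: sum.neutral)
    qed
    also have "0 \<le> (\<Prod>i<Suc n. G i i)"
      using diag by (intro prod_nonneg) auto
    finally show ?thesis .
  next
    case False
    then have a: "0 < G 0 0" using diag[of 0] by simp
    define H where "H i j = G (Suc i) (Suc j) - G (Suc i) 0 * G 0 (Suc j) / G 0 0" for i j
    have H_psd: "0 \<le> (\<Sum>i<n. \<Sum>j<n. x i * H i j * x j)" for x
    proof -
      let ?b = "\<Sum>i<n. x i * G 0 (Suc i)"
      have "(\<Sum>i<n. \<Sum>j<n. x i * H i j * x j)
        = (\<Sum>i<n. \<Sum>j<n. x i * G (Suc i) (Suc j) * x j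
            - (x i * G 0 (Suc i)) * (x j * G 0 (Suc j)) / G 0 0)"
        using Suc.prems(1) by (intro sum.cong) (auto simp: H_def algebra_simps)
      also have "\<dots> = (\<Sum>i<n. \<Sum>j<n. x i * G (Suc i) (Suc j) * x j) - ?b * ?b / G 0 0"
        by (simp add: sum_subtractf sum_product sum_divide_distrib)
      \<comment> \<open>The form of \<open>H\<close> at \<open>x\<close> is the minimum of
        \<open>quad\<close> over \<open>t\<close>, attained at \<open>- ?b / G 0 0\<close>.\<close>
      also have "\<dots> = (- ?b / G 0 0)\<^sup>2 * G 0 0 + 2 * (- ?b / G 0 0) * ?b
          + (\<Sum>i<n. \<Sum>j<n. x i * G (Suc i) (Suc j) * x j)"
        using a by (simp add: power2_eq_square)
      finally show ?thesis
        using quad[of "- ?b / G 0 0" x] by simp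
    qed
    have H_sym: "H i j = H j i" if "i < n" "j < n" for i j
      using Suc.prems(1)[of 0 "Suc i"] Suc.prems(1)[of 0 "Suc j"]
        Suc.prems(1)[of "Suc i" "Suc j"] that by (simp add: H_def)
    have H_diag: "0 \<le> H i i" if "i < n" for i
      using H_psd[of "unit_fun i"] unit_fun_quadratic_form[OF that, of H] by simp
    have H_le: "H i i \<le> G (Suc i) (Suc i)" if "i < n" for i
      using a that Suc.prems(1)[of 0 "Suc i"] by (simp add: H_def)
    have "det (mat (Suc n) (Suc n) (\<lambda>(i, j). G i j)) = G 0 0 * det (mat n n (\<lambda>(i, j). H i j))"
      unfolding H_def by (rule det_first_pivot[where G = G, OF False])
    also have "\<dots> \<le> G 0 0 * (\<Prod>i<n. H i i)"
      using Suc.IH[OF H_sym H_psd] a by simp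
    also have "\<dots> \<le> G 0 0 * (\<Prod>i<n. G (Suc i) (Suc i))"
      using a H_diag H_le by (intro mult_left_mono prod_mono) auto
    also have "\<dots> = (\<Prod>i<Suc n. G i i)"
      by (rule prod.lessThan_Suc_shift[symmetric])
    finally show ?thesis .
  qed
qed

text \<open>\<open>G\<close> is the Gram matrix of the rows, that is \<open>?A\<close> times its
  transpose. Its determinant is the square of \<open>det ?A\<close>, and each diagonal entry is a
  sum of \<open>n\<close> squares of size at most 1.\<close>

lemma hadamard_unit_entries:
  assumes "\<And>k i. k < n \<Longrightarrow> i < n \<Longrightarrow> \<bar>B k i\<bar> \<le> 1"
  shows "\<bar>det (cols_mat n B)\<bar> \<le> sqrt (real n) ^ n"
proof -
  define G where "G i j = (\<Sum>k<n. B k i * B k j)" for i j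
  let ?A = "cols_mat n B"
  have "0 \<le> (\<Sum>i<n. \<Sum>j<n. x i * G i j * x j)" for x
  proof -
    have "(\<Sum>i<n. \<Sum>j<n. x i * G i j * x j)
      = (\<Sum>i<n. \<Sum>j<n. \<Sum>k<n. (x i * B k i) * (x j * B k j))"
      by (intro sum.cong) (auto simp: G_def sum_distrib_left sum_distrib_right algebra_simps)
    also have "\<dots> = (\<Sum>i<n. \<Sum>k<n. \<Sum>j<n. (x i * B k i) * (x j * B k j))"
      by (intro sum.cong refl sum.swap)
    also have "\<dots> = (\<Sum>k<n. \<Sum>i<n. \<Sum>j<n. (x i * B k i) * (x j * B k j))"
      by (rule sum.swap)
    also have "\<dots> = (\<Sum>k<n. (\<Sum>i<n. x i * B k i)\<^sup>2)"
      by (simp add: power2_eq_square sum_product)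
    finally show ?thesis by (simp add: sum_nonneg)
  qed
  then have "det (mat n n (\<lambda>(i, j). G i j)) \<le> (\<Prod>i<n. G i i)"
    by (intro psd_det_le_prod_diag) (auto simp: G_def mult.commute)
  also have "\<dots> \<le> (\<Prod>i<n. real n)"
  proof (intro prod_mono conjI)
    fix i assume "i \<in> {..<n}"
    then have "B k i * B k i \<le> 1" if "k < n" for k
      using assms[of k i] that abs_square_le_1[of "B k i"] by (simp add: power2_eq_square)
    then have "G i i \<le> (\<Sum>k<n. 1)"
      unfolding G_def by (intro sum_mono) auto
    then show "G i i \<le> real n" by simp
  qed (auto simp: G_def intro: sum_nonneg)
  also have "mat n n (\<lambda>(i, j). G i j) = ?A * transpose_mat ?A"
    by (rule eq_matI) (auto simp: G_def cols_mat_def scalar_prod_def lessThan_atLeast0)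
  also have "det \<dots> = (det ?A)\<^sup>2"
    by (simp add: det_mult[of _ n] det_transpose[of _ n] power2_eq_square)
  finally have "(det ?A)\<^sup>2 \<le> real n ^ n" by simp
  then show ?thesis
    using real_le_rsqrt[of "\<bar>det ?A\<bar>" "real n ^ n"] by (simp add: real_sqrt_power)
qed

section \<open>Gordan's theorem\<close>

text \<open>No rule supplies the zero vector outright, so every element is a combination with at
  least one positive coefficient. A vanishing element therefore witnesses a nontrivial
  dependence.\<close>

inductive_set pos_cone :: "(nat \<Rightarrow> real) set \<Rightarrow> (nat \<Rightarrow> real) set" for S where
  base: "v \<in> S \<Longrightarrow> v \<in> pos_cone S"
| add: "u \<in> pos_cone S \<Longrightarrow> v \<in> pos_cone S \<Longrightarrow> (\<lambda>i. u i + v i) \<in> pos_cone S"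
| scale: "v \<in> pos_cone S \<Longrightarrow> 0 < c \<Longrightarrow> (\<lambda>i. c * v i) \<in> pos_cone S"

lemma pos_cone_combination:
  assumes "z \<in> pos_cone S" and "finite S"
  shows "\<exists>c. (\<forall>v\<in>S. 0 \<le> c v) \<and> (\<exists>v\<in>S. 0 < c v) \<and> (\<forall>i. z i = (\<Sum>v\<in>S. c v * v i))"
  using assms(1)
proof induction
  case (base v)
  have "v i = (\<Sum>u\<in>S. (if u = v then 1 else 0) * u i)" for i
  proof -
    have "(\<Sum>u\<in>S. (if u = v then 1 else 0) * u i) = (\<Sum>u\<in>S. if u = v then u i else 0)"
      by (intro sum.cong) auto
    then show ?thesis using base assms(2) by (simp add: sum.delta)
  qed
  then show ?case
    using base by (intro exI[of _ "\<lambda>u. if u = v then 1 else 0"]) auto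
next
  case (add u v)
  then obtain c d where "\<forall>v\<in>S. 0 \<le> c v" and pos: "\<exists>v\<in>S. 0 < c v"
    and "\<forall>i. u i = (\<Sum>v\<in>S. c v * v i)"
    and "\<forall>v\<in>S. 0 \<le> d v" "\<forall>i. v i = (\<Sum>v\<in>S. d v * v i)"
    by blast
  moreover from this have "\<exists>v\<in>S. 0 < c v + d v"
    by (metis add_pos_nonneg)
  ultimately show ?case
    by (intro exI[of _ "\<lambda>v. c v + d v"]) (auto simp: distrib_right sum.distrib)
next
  case (scale v a)
  then obtain c where "\<forall>v\<in>S. 0 \<le> c v" and "\<exists>v\<in>S. 0 < c v"
    and "\<forall>i. v i = (\<Sum>v\<in>S. c v * v i)"
    by blast
  moreover from this scale(2) have "\<exists>v\<in>S. 0 < a * c v"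
    by (metis mult_pos_pos)
  ultimately show ?case
    using scale(2) by (intro exI[of _ "\<lambda>v. a * c v"])
      (auto simp: sum_distrib_left mult.assoc)
qed

text \<open>Picks the value of an eliminated variable between its lower and its upper bounds. Either
  set may be empty, in which case \<open>Max\<close> or \<open>Min\<close> says nothing and the
  variable is bounded on one side at most.\<close>

lemma finite_sets_separated:
  fixes A B :: "real set"
  assumes "finite A" "finite B" and "\<And>a b. a \<in> A \<Longrightarrow> b \<in> B \<Longrightarrow> a < b"
  obtains t where "\<And>a. a \<in> A \<Longrightarrow> a < t" and "\<And>b. b \<in> B \<Longrightarrow> t < b"
proof -
  consider "A = {}" | "B = {}" | "A \<noteq> {}" "B \<noteq> {}" by blast
  then show ?thesis
  proof cases
    case 1
    have "Min B - 1 < b" if "b \<in> B" for b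
      using Min_le[OF assms(2) that] by simp
    with 1 show ?thesis by (intro that) auto
  next
    case 2
    have "a < Max A + 1" if "a \<in> A" for a
      using Max_ge[OF assms(1) that] by simp
    with 2 show ?thesis by (intro that) auto
  next
    case 3
    then have "Max A < Min B"
      using assms by simp
    then obtain t where "Max A < t" "t < Min B"
      using dense by blast
    with 3 assms(1,2) show ?thesis
      by (intro that[of t]) auto
  qed
qed

text \<open>Fourier--Motzkin: the last coordinate is eliminated by pairing the vectors on which it is
  positive with those on which it is negative.\<close>

lemma gordan:
  assumes "finite S"
  shows "(\<exists>w. \<forall>v\<in>S. 0 < (\<Sum>i<n. w i * v i)) \<or> (\<exists>z\<in>pos_cone S. \<forall>i<n. z i = 0)"
  using assms
proof (induction n arbitrary: S)
  case 0
  then show ?case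
    by (cases "S = {}") (auto intro: pos_cone.base)
next
  case (Suc n)
  \<comment> \<open>For \<open>u\<close> in \<open>Pos\<close> and \<open>v\<close> in
    \<open>Neg\<close> both factors are positive, and coordinate \<open>n\<close> cancels.\<close>
  define comb where "comb u v = (\<lambda>i. - v n * u i + u n * v i)" for u v :: "nat \<Rightarrow> real"
  define Pos Neg where "Pos = {v \<in> S. 0 < v n}" and "Neg = {v \<in> S. v n < 0}"
  define S' where "S' = {v \<in> S. v n = 0} \<union> (\<lambda>(u, v). comb u v) ` (Pos \<times> Neg)"
  have fin: "finite Pos" "finite Neg" "finite S'"
    using Suc.prems by (auto simp: Pos_def Neg_def S'_def)
  \<comment> \<open>A dependence found among the vectors of \<open>S'\<close> is one among those of
    \<open>S\<close>, and it also vanishes at coordinate \<open>n\<close>.\<close>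
  have cone: "z \<in> pos_cone S \<and> z n = 0" if "z \<in> pos_cone S'" for z
    using that
  proof induction
    case (base z)
    show ?case
    proof (cases "z \<in> S \<and> z n = 0")
      case True
      then show ?thesis by (auto intro: pos_cone.base)
    next
      case False
      then obtain u v where uv: "u \<in> S" "0 < u n" "v \<in> S" "v n < 0" "z = comb u v"
        using base by (auto simp: S'_def Pos_def Neg_def)
      then have "comb u v \<in> pos_cone S"
        unfolding comb_def by (intro pos_cone.intros) auto
      then show ?thesis using uv by (simp add: comb_def)
    qed
  qed (auto intro: pos_cone.intros)
  consider w where "\<forall>v\<in>S'. 0 < (\<Sum>i<n. w i * v i)"
    | z where "z \<in> pos_cone S'" "\<forall>i<n. z i = 0"
    using Suc.IH[OF fin(3)] by blast
  then show ?case
  proof cases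
    case (1 w)
    define f where "f v = (\<Sum>i<n. w i * v i)" for v
    have comb_pos: "0 < - v n * f u + u n * f v" if "u \<in> Pos" "v \<in> Neg" for u v
    proof -
      have "comb u v \<in> S'" using that by (auto simp: S'_def)
      then have "0 < f (comb u v)" using 1 by (simp add: f_def)
      also have "f (comb u v) = - v n * f u + u n * f v"
        by (simp add: f_def comb_def sum.distrib sum_distrib_left sum_subtractf sum_negf algebra_simps)
      finally show ?thesis .
    qed
    \<comment> \<open>\<open>t\<close> becomes the weight of coordinate \<open>n\<close>. Vectors in
      \<open>Pos\<close> bound it from below, those in \<open>Neg\<close> from above, and
      \<open>comb_pos\<close> puts each lower bound below each upper one.\<close>
    obtain t where t: "\<And>a. a \<in> (\<lambda>u. - f u / u n) ` Pos \<Longrightarrow> a < t"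
      "\<And>b. b \<in> (\<lambda>v. - f v / v n) ` Neg \<Longrightarrow> t < b"
    proof (rule finite_sets_separated)
      fix a b assume "a \<in> (\<lambda>u. - f u / u n) ` Pos" "b \<in> (\<lambda>v. - f v / v n) ` Neg"
      then obtain u v where uv: "u \<in> Pos" "v \<in> Neg" "a = - f u / u n" "b = - f v / v n" by auto
      then have "0 < u n" "v n < 0" by (auto simp: Pos_def Neg_def)
      then have "a * (u n * - v n) = f u * v n" "b * (u n * - v n) = - f v * - u n"
        using uv(3,4) by simp_all
      then have "a * (u n * - v n) < b * (u n * - v n)"
        using comb_pos[OF uv(1,2)] by (simp add: mult.commute)
      moreover have "0 < u n * - v n"
        using \<open>0 < u n\<close> \<open>v n < 0\<close> by (intro mult_pos_pos) auto
      ultimately show "a < b"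
        by (metis mult_less_cancel_right_pos)
    qed (use fin in auto)
    have "0 < (\<Sum>i<Suc n. (w(n := t)) i * v i)" if v: "v \<in> S" for v
    proof -
      have *: "(\<Sum>i<Suc n. (w(n := t)) i * v i) = f v + t * v n"
        by (simp add: f_def)
      consider "v n = 0" | "v \<in> Pos" | "v \<in> Neg"
        using v by (cases "v n" "0 :: real" rule: linorder_cases) (auto simp: Pos_def Neg_def)
      then show ?thesis
      proof cases
        case 1
        then show ?thesis
          using * v \<open>\<forall>v\<in>S'. 0 < _\<close> by (simp add: f_def S'_def)
      next
        case 2
        then have "0 < v n" "- f v / v n < t" using t(1) by (auto simp: Pos_def)
        then show ?thesis using * by (simp add: field_simps)
      next
        case 3
        then have "v n < 0" "t < - f v / v n" using t(2) by (auto simp: Neg_def)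
        then show ?thesis using * by (simp add: field_simps)
      qed
    qed
    then show ?thesis by blast
  next
    case (2 z)
    with cone[of z] show ?thesis by (auto simp: less_Suc_eq)
  qed
qed

section \<open>Minimal positive dependences and completion to a basis\<close>

text \<open>For finite \<open>T\<close>, distinct functions that agree below \<open>n\<close> count
  as dependent.\<close>

definition indep :: "nat \<Rightarrow> (nat \<Rightarrow> real) set \<Rightarrow> bool" where
  "indep n T \<longleftrightarrow> (\<forall>d. (\<forall>i<n. (\<Sum>u\<in>T. d u * u i) = 0) \<longrightarrow> (\<forall>u\<in>T. d u = 0))"

text \<open>A reduction as in Caratheodory's theorem. If all coefficients are positive but the
  vectors other than \<open>v\<close> are dependent, a multiple of their dependence is subtracted
  until some coefficient vanishes. The coefficient of \<open>v\<close> is untouched, so the relation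
  stays nontrivial on a smaller set.\<close>

lemma minimal_positive_dependence:
  assumes "finite S" and "\<And>u. u \<in> S \<Longrightarrow> 0 \<le> c u" and "\<exists>u\<in>S. 0 < c u"
    and "\<And>i. i < n \<Longrightarrow> (\<Sum>u\<in>S. c u * u i) = 0"
  obtains v T c' where "insert v T \<subseteq> S" "v \<notin> T" "indep n T"
    "\<And>u. u \<in> insert v T \<Longrightarrow> 0 < c' u"
    "\<And>i. i < n \<Longrightarrow> (\<Sum>u\<in>insert v T. c' u * u i) = 0"
  using assms
proof (induction S arbitrary: c thesis rule: finite_psubset_induct)
  case (psubset S)
  have smaller: thesis if "B \<subset> S" "\<And>u. u \<in> B \<Longrightarrow> 0 \<le> c' u" "\<exists>u\<in>B. 0 < c' u"
    "\<And>i. i < n \<Longrightarrow> (\<Sum>u\<in>B. c' u * u i) = 0" for B c'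
  proof (rule psubset.IH[OF that(1) _ that(2,3,4)])
    fix T v c''
    assume *: "insert v T \<subseteq> B" "v \<notin> T" "indep n T" "\<And>u. u \<in> insert v T \<Longrightarrow> 0 < c'' u"
      "\<And>i. i < n \<Longrightarrow> (\<Sum>u\<in>insert v T. c'' u * u i) = 0"
    show thesis
      by (rule psubset.prems(1)[OF _ *(2-5)]) (use * that(1) in auto)
  qed
  show thesis
  proof (cases "\<exists>u\<in>S. c u = 0")
    case True
    then obtain u where u: "u \<in> S" "c u = 0" by blast
    have "(\<Sum>u\<in>S - {u}. c u * u i) = 0" if "i < n" for i
      using psubset.prems(4)[OF that] u psubset.hyps by (simp add: sum.remove)
    moreover have "\<exists>w\<in>S - {u}. 0 < c w" using psubset.prems(3) u by force
    moreover have "S - {u} \<subset> S" using u by blast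
    ultimately show thesis
      using smaller[of "S - {u}" c] psubset.prems(2) by auto
  next
    case False
    then have pos: "0 < c u" if "u \<in> S" for u
      using psubset.prems(2)[OF that] that by (metis order_le_less)
    obtain v where v: "v \<in> S" using psubset.prems(3) by blast
    define T where "T = S - {v}"
    have S: "S = insert v T" "v \<notin> T" "finite T" using v psubset.hyps by (auto simp: T_def)
    show thesis
    proof (cases "indep n T")
      case True
      then show thesis
        using psubset.prems(1)[of v T c] psubset.prems(4) S pos by auto
    next
      case False
      then obtain d0 u0 where d0: "\<And>i. i < n \<Longrightarrow> (\<Sum>u\<in>T. d0 u * u i) = 0" "u0 \<in> T" "d0 u0 \<noteq> 0"
        by (auto simp: indep_def)
      \<comment> \<open>The dependence \<open>d0\<close> is extended by 0 at \<open>v\<close>, and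
        its sign is chosen so that \<open>d u0\<close> is positive; hence \<open>D\<close> below is
        nonempty.\<close>
      define d where "d u = (if u = v then 0 else if 0 < d0 u0 then d0 u else - d0 u)" for u
      have d: "(\<Sum>u\<in>S. d u * u i) = 0" if "i < n" for i
      proof -
        have "(\<Sum>u\<in>S. d u * u i) = (\<Sum>u\<in>T. (if 0 < d0 u0 then 1 else -1) * (d0 u * u i))"
          unfolding S(1) using S(2,3) by (auto simp: d_def intro!: sum.cong)
        also have "\<dots> = 0"
          using d0(1)[OF that] by (simp flip: sum_distrib_left)
        finally show ?thesis .
      qed
      define D where "D = {u \<in> T. 0 < d u}"
      have D: "finite D" "u0 \<in> D"
        using S d0 by (auto simp: D_def d_def)
      then obtain m where m: "m \<in> D" "\<And>u. u \<in> D \<Longrightarrow> c m / d m \<le> c u / d u"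
        using arg_min_least[of D _ "\<lambda>u. c u / d u"] arg_min_if_finite(1)[of D "\<lambda>u. c u / d u"]
        by blast
      \<comment> \<open>The least ratio is the largest step that keeps all coefficients nonnegative;
        the coefficient of \<open>m\<close> drops to 0.\<close>
      define t where "t = c m / d m"
      define c' where "c' u = c u - t * d u" for u
      have mS: "m \<in> S" "0 < d m" using m S by (auto simp: D_def)
      have t: "0 < t" using pos mS by (simp add: t_def)
      have "0 \<le> c' u" if "u \<in> S" for u
      proof (cases "u \<in> D")
        case True
        then have "0 < d u" by (simp add: D_def)
        then show ?thesis using m(2)[OF True] by (simp add: c'_def t_def field_simps)
      next
        case False
        then have "d u \<le> 0" using that S by (auto simp: D_def d_def)
        then have "t * d u \<le> 0" using t by (simp add: mult_nonneg_nonpos)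
        then show ?thesis using pos[OF that] by (simp add: c'_def)
      qed
      moreover have "c' m = 0" using mS by (simp add: c'_def t_def)
      moreover have "0 < c' v" using pos[OF v] by (simp add: c'_def d_def)
      moreover have c'0: "(\<Sum>u\<in>S. c' u * u i) = 0" if "i < n" for i
        using d[OF that] psubset.prems(4)[OF that]
        by (simp add: c'_def left_diff_distrib sum_subtractf mult.assoc flip: sum_distrib_left)
      moreover have "(\<Sum>u\<in>S - {m}. c' u * u i) = 0" if "i < n" for i
        using c'0[OF that] \<open>c' m = 0\<close> mS psubset.hyps by (simp add: sum.remove)
      moreover have "m \<noteq> v" using m S by (auto simp: D_def)
      moreover have "S - {m} \<subset> S" using mS by blast
      ultimately show thesis
        using smaller[of "S - {m}" c'] v by auto
    qed
  qed
qed

text \<open>Steinitz exchange, starting from the unit vectors. A new vector \<open>v\<close> is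
  expanded in the current basis; independence gives a nonzero coefficient at a column outside
  \<open>T\<close>, and replacing that column by \<open>v\<close> multiplies the determinant by this
  coefficient.\<close>

lemma extend_indep:
  assumes "finite T" and "indep n T"
  shows "\<exists>B. T \<subseteq> B ` {..<n} \<and> (\<forall>k<n. B k \<in> T \<union> unit_fun ` {..<n}) \<and> det (cols_mat n B) \<noteq> 0"
  using assms
proof (induction T)
  case empty
  then show ?case
    by (intro exI[of _ unit_fun]) (auto simp: cols_mat_unit_fun)
next
  case (insert v T)
  have dep: "\<forall>u\<in>insert v T. d u = 0"
    if "\<And>i. i < n \<Longrightarrow> (\<Sum>u\<in>insert v T. d u * u i) = 0" for d
    using insert.prems that by (auto simp: indep_def)
  have "indep n T"
    unfolding indep_def
  proof (intro allI impI)
    fix d assume d: "\<forall>i<n. (\<Sum>u\<in>T. d u * u i) = 0"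
    let ?d = "\<lambda>u. if u = v then 0 else d u"
    have "(\<Sum>u\<in>insert v T. ?d u * u i) = (\<Sum>u\<in>T. d u * u i)" for i
      using insert.hyps by (auto intro!: sum.cong)
    then have "\<forall>u\<in>insert v T. ?d u = 0"
      using d by (intro dep) metis
    then show "\<forall>u\<in>T. d u = 0"
      using insert.hyps by (metis insertCI)
  qed
  then obtain B where B: "T \<subseteq> B ` {..<n}" "\<And>k. k < n \<Longrightarrow> B k \<in> T \<union> unit_fun ` {..<n}"
    "det (cols_mat n B) \<noteq> 0"
    using insert.IH by blast
  obtain x where x: "\<And>i. i < n \<Longrightarrow> v i = (\<Sum>k<n. x k * B k i)"
    using solve_columns[OF B(3), of v] by blast
  have "\<exists>k<n. B k \<notin> T \<and> x k \<noteq> 0"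
  proof (rule ccontr)
    assume *: "\<not> ?thesis"
    \<comment> \<open>If \<open>v\<close> were a combination of columns in \<open>T\<close> alone,
      moving it to one side would give a dependence with coefficient 1 at \<open>v\<close>. Columns
      carrying the same vector are collected into one coefficient.\<close>
    define d where "d u = (if u = v then 1 else - (\<Sum>k | k < n \<and> B k = u. x k))" for u
    have "(\<Sum>u\<in>insert v T. d u * u i) = 0" if "i < n" for i
    proof -
      have "v i = (\<Sum>k | k < n \<and> B k \<in> T. x k * B k i)"
        unfolding x[OF that] using * by (intro sum.mono_neutral_right) auto
      also have "\<dots> = (\<Sum>u\<in>T. \<Sum>k | k \<in> {k. k < n \<and> B k \<in> T} \<and> B k = u. x k * B k i)"
        using insert.hyps by (intro sum.group[symmetric]) auto
      also have "\<dots> = (\<Sum>u\<in>T. (\<Sum>k | k < n \<and> B k = u. x k) * u i)"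
        unfolding sum_distrib_right by (intro sum.cong) auto
      also have "\<dots> = - (\<Sum>u\<in>T. d u * u i)"
        unfolding sum_negf[symmetric] using insert.hyps by (intro sum.cong) (auto simp: d_def)
      finally show ?thesis using insert.hyps by (simp add: d_def)
    qed
    from dep[OF this] show False by (simp add: d_def)
  qed
  then obtain k where k: "k < n" "B k \<notin> T" "x k \<noteq> 0" by blast
  have "det (cols_mat n (B(k := v))) \<noteq> 0"
    using det_replace_column[OF x k(1)] B(3) k(3) by simp
  moreover have "insert v T \<subseteq> (B(k := v)) ` {..<n}"
  proof
    fix u assume "u \<in> insert v T"
    then consider "u = v" | j where "j < n" "u = B j" "u \<in> T" using B(1) by auto
    then show "u \<in> (B(k := v)) ` {..<n}"
    proof cases
      case 1
      then show ?thesis using k by (intro image_eqI[of _ _ k]) auto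
    next
      case 2
      then show ?thesis using k by (intro image_eqI[of _ _ j]) auto
    qed
  qed
  moreover have "\<forall>j<n. (B(k := v)) j \<in> insert v T \<union> unit_fun ` {..<n}"
    using B(2) by auto
  ultimately show ?case by blast
qed

section \<open>Integer dependences with small coefficients\<close>

text \<open>A minimal dependence expresses \<open>v\<close> in a basis containing \<open>T\<close>.
  Scaling it by the determinant of that basis turns each coefficient, by Cramer's rule, into the
  absolute value of a determinant. As \<open>T\<close> sits among \<open>n\<close> columns, at most
  \<open>n + 1\<close> coefficients occur.\<close>

lemma small_integer_dependence:
  fixes S :: "(nat \<Rightarrow> real) set"
  assumes "finite S" and entries: "\<And>u i. u \<in> S \<Longrightarrow> u i \<in> {-1, 0, 1}"
    and "z \<in> pos_cone S" and "\<And>i. i < n \<Longrightarrow> z i = 0"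
  obtains R and m :: "(nat \<Rightarrow> real) \<Rightarrow> nat" where "R \<subseteq> S" "card R \<le> n + 1" "\<exists>u\<in>R. 0 < m u"
    "\<And>u. u \<in> R \<Longrightarrow> real (m u) \<le> sqrt (real n) ^ n"
    "\<And>i. i < n \<Longrightarrow> (\<Sum>u\<in>R. real (m u) * u i) = 0"
proof -
  obtain c0 where c0: "\<And>u. u \<in> S \<Longrightarrow> 0 \<le> c0 u" "\<exists>u\<in>S. 0 < c0 u"
    "\<And>i. z i = (\<Sum>u\<in>S. c0 u * u i)"
    using pos_cone_combination[OF assms(3,1)] by blast
  have c0_sum: "(\<Sum>u\<in>S. c0 u * u i) = 0" if "i < n" for i
    using c0(3) assms(4)[OF that] by simp
  obtain v T c where T: "insert v T \<subseteq> S" "v \<notin> T" "indep n T"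
    and c: "\<And>u. u \<in> insert v T \<Longrightarrow> 0 < c u"
    and dep: "\<And>i. i < n \<Longrightarrow> (\<Sum>u\<in>insert v T. c u * u i) = 0"
  proof (rule minimal_positive_dependence[OF assms(1) _ c0(2) c0_sum])
    show "0 \<le> c0 u" if "u \<in> S" for u using that by (rule c0(1))
  next
    fix v T c
    assume "insert v T \<subseteq> S" "v \<notin> T" "indep n T" "\<And>u. u \<in> insert v T \<Longrightarrow> 0 < c u"
      "\<And>i. i < n \<Longrightarrow> (\<Sum>u\<in>insert v T. c u * u i) = 0"
    then show thesis by (rule that)
  qed
  have fin: "finite T" using T(1) assms(1) by (auto intro: finite_subset)
  obtain B where B: "T \<subseteq> B ` {..<n}" "\<And>k. k < n \<Longrightarrow> B k \<in> T \<union> unit_fun ` {..<n}"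
    "det (cols_mat n B) \<noteq> 0"
    using extend_indep[OF fin T(3)] by blast
  define D where "D = det (cols_mat n B)"
  define idx where "idx = inv_into {..<n} B"
  have idx: "idx u < n" "B (idx u) = u" if "u \<in> T" for u
    using B(1) that inv_into_into[of u B "{..<n}"] f_inv_into_f[of u B "{..<n}"]
    by (auto simp: idx_def)
  have inj: "inj_on idx T" using idx(2) by (metis inj_onI)
  \<comment> \<open>The coordinates of \<open>v\<close> in the basis \<open>B\<close>, obtained by
    solving the dependence for \<open>v\<close>; they are 0 at the columns added for
    completion.\<close>
  define x where "x k = (if k \<in> idx ` T then - c (B k) / c v else 0)" for k
  have v: "v i = (\<Sum>k<n. x k * B k i)" if "i < n" for i
  proof -
    have "(\<Sum>k<n. x k * B k i) = (\<Sum>k\<in>idx ` T. x k * B k i)"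
      using idx(1) by (intro sum.mono_neutral_right) (auto simp: x_def)
    also have "\<dots> = (\<Sum>u\<in>T. x (idx u) * B (idx u) i)"
      using inj by (simp add: sum.reindex)
    also have "\<dots> = (\<Sum>u\<in>T. - 1 / c v * (c u * u i))"
      using idx(2) by (intro sum.cong) (auto simp: x_def)
    also have "\<dots> = - 1 / c v * (\<Sum>u\<in>T. c u * u i)"
      by (simp only: sum_distrib_left)
    also have "(\<Sum>u\<in>T. c u * u i) = - c v * v i"
      using dep[OF that] fin T(2) by simp
    finally show ?thesis using c[of v] by simp
  qed
  \<comment> \<open>Stated for arbitrary columns, since it is applied to \<open>B\<close> and to
    \<open>B\<close> with one column replaced by \<open>v\<close>.\<close>
  have small: "\<bar>det (cols_mat n C)\<bar> \<in> \<int>" "\<bar>det (cols_mat n C)\<bar> \<le> sqrt (real n) ^ n"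
    if C: "\<And>k. k < n \<Longrightarrow> C k \<in> S \<union> unit_fun ` {..<n}" for C
  proof -
    have "C k i \<in> \<int> \<and> \<bar>C k i\<bar> \<le> 1" if "k < n" for k i
    proof (cases "C k \<in> S")
      case True
      show ?thesis using entries[OF True, of i] by auto
    next
      case False
      then show ?thesis using C[OF that] by (auto simp: unit_fun_def)
    qed
    then show "\<bar>det (cols_mat n C)\<bar> \<in> \<int>" "\<bar>det (cols_mat n C)\<bar> \<le> sqrt (real n) ^ n"
      by (simp_all add: det_cols_mat_Ints hadamard_unit_entries)
  qed
  \<comment> \<open>The scaling gives \<open>v\<close> the coefficient \<open>\<bar>D\<bar>\<close>,
    while \<open>u\<close> in \<open>T\<close> gets the absolute determinant of \<open>B\<close>
    with \<open>u\<close> replaced by \<open>v\<close>.\<close>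
  define M where "M u = \<bar>D\<bar> * c u / c v" for u
  have M: "M u \<in> \<int> \<and> M u \<le> sqrt (real n) ^ n" if "u \<in> insert v T" for u
  proof (cases "u = v")
    case True
    then show ?thesis
      using small[of B] B(2) T(1) c[of v] by (auto simp: M_def D_def)
  next
    case False
    then have u: "u \<in> T" using that by simp
    let ?C = "B(idx u := v)"
    have "\<bar>det (cols_mat n ?C)\<bar> = M u"
      using det_replace_column[OF v idx(1)[OF u]] idx(2)[OF u] u c[of u] c[of v]
      by (simp add: x_def M_def D_def abs_mult)
    moreover have "?C k \<in> S \<union> unit_fun ` {..<n}" if "k < n" for k
      using B(2)[OF that] T(1) by auto
    ultimately show ?thesis using small[of ?C] by metis
  qed
  have M_pos: "0 < M u" if "u \<in> insert v T" for u
    using c[OF that] c[of v] B(3) by (simp add: M_def D_def)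
  \<comment> \<open>The floor changes nothing: on \<open>insert v T\<close> the values of
    \<open>M\<close> are positive integers.\<close>
  define m where "m u = nat \<lfloor>M u\<rfloor>" for u
  have m: "real (m u) = M u" if "u \<in> insert v T" for u
    using M[OF that] M_pos[OF that] by (auto simp: m_def elim!: Ints_cases)
  show thesis
  proof
    show "insert v T \<subseteq> S" by fact
    have "card T \<le> card (B ` {..<n})" using B(1) by (intro card_mono) auto
    also have "\<dots> \<le> n" using card_image_le[of "{..<n}" B] by simp
    finally show "card (insert v T) \<le> n + 1" using T(2) fin by simp
    show "\<exists>u\<in>insert v T. 0 < m u" using m[of v] M_pos[of v] by force
    show "real (m u) \<le> sqrt (real n) ^ n" if "u \<in> insert v T" for u
      using m[OF that] M[OF that] by simp
    show "(\<Sum>u\<in>insert v T. real (m u) * u i) = 0" if "i < n" for i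
    proof -
      have "(\<Sum>u\<in>insert v T. real (m u) * u i) = (\<Sum>u\<in>insert v T. \<bar>D\<bar> / c v * (c u * u i))"
        by (intro sum.cong) (auto simp: m M_def)
      also have "\<dots> = 0"
        using dep[OF that] by (simp only: sum_distrib_left[symmetric])
      finally show ?thesis .
    qed
  qed
qed

section \<open>Weights and trading transforms\<close>

text \<open>Double counting: the total weight of a list of coalitions depends only on how often each
  player occurs, so both halves of a trading transform weigh the same.\<close>

lemma sum_list_weights_eq_sum_card:
  fixes w :: "'a \<Rightarrow> real"
  assumes "finite P" and "set Xs \<subseteq> Pow P"
  shows "(\<Sum>X\<leftarrow>Xs. sum w X) = (\<Sum>a\<in>P. w a * card {i. i < length Xs \<and> a \<in> Xs ! i})"
proof -
  have "(\<Sum>X\<leftarrow>Xs. sum w X) = (\<Sum>a\<in>P. w a * real (length (filter ((\<in>) a) Xs)))"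
    using assms(2)
  proof (induction Xs)
    case (Cons X Xs)
    have "sum w X = (\<Sum>a\<in>P. if a \<in> X then w a else 0)"
      using Cons.prems assms(1) by (simp add: sum.inter_restrict[symmetric] Int_absorb1)
    then have "(\<Sum>X\<leftarrow>X # Xs. sum w X)
      = (\<Sum>a\<in>P. (if a \<in> X then w a else 0) + w a * real (length (filter ((\<in>) a) Xs)))"
      using Cons by (simp add: sum.distrib)
    also have "\<dots> = (\<Sum>a\<in>P. w a * real (length (filter ((\<in>) a) (X # Xs))))"
      by (intro sum.cong) (auto simp: algebra_simps)
    finally show ?case .
  qed simp
  then show ?thesis by (simp add: length_filter_conv_card)
qed

text \<open>With \<open>j\<close> coalitions on each side, the winning ones weigh at least
  \<open>j * q\<close> in total and the losing ones less, strictly because the lists are nonempty;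
  but the totals agree.\<close>

lemma weighted_imp_trade_robust:
  fixes P :: "'a set"
  assumes "finite P" and "weighted_majority_game P W"
  shows "trade_robust k P W"
  unfolding trade_robust_def
proof (intro notI, elim exE conjE)
  fix Xs Ys assume tt: "trading_transform P Xs Ys" and W: "set Xs \<subseteq> W" and L: "set Ys \<subseteq> losing P W"
  obtain w :: "'a \<Rightarrow> real" and q where wq: "\<And>X. X \<subseteq> P \<Longrightarrow> X \<in> W \<longleftrightarrow> q \<le> sum w X"
    using assms(2) unfolding weighted_majority_game_def by blast
  have sets: "set Xs \<subseteq> Pow P" "set Ys \<subseteq> Pow P" and len: "length Xs = length Ys" and ne: "Ys \<noteq> []"
    using tt by (auto simp: trading_transform_def)
  have X: "q \<le> sum w X" if "X \<in> set Xs" for X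
    using wq[of X] that W sets(1) by auto
  have Y: "sum w Y < q" if "Y \<in> set Ys" for Y
    using wq[of Y] that L sets(2) by (auto simp: losing_def)
  have "(\<Sum>X\<leftarrow>Xs. q) \<le> (\<Sum>X\<leftarrow>Xs. sum w X)"
    by (intro sum_list_mono X)
  also have "\<dots> = (\<Sum>Y\<leftarrow>Ys. sum w Y)"
    unfolding sum_list_weights_eq_sum_card[OF assms(1) sets(1)]
      sum_list_weights_eq_sum_card[OF assms(1) sets(2)]
    using tt by (intro sum.cong) (auto simp: trading_transform_def)
  also have "\<dots> < (\<Sum>Y\<leftarrow>Ys. q)"
    by (intro sum_list_strict_mono ne Y)
  finally show False using len by (simp add: sum_list_triv)
qed

text \<open>Negative weights may be truncated to \<open>0\<close>: removing the players of negative weight keeps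
  a losing coalition losing.\<close>

lemma separated_imp_weighted:
  fixes w :: "'a \<Rightarrow> real"
  assumes game: "simple_game P W"
    and sep: "\<And>X Y. X \<in> W \<Longrightarrow> Y \<in> losing P W \<Longrightarrow> sum w Y < sum w X"
  shows "weighted_majority_game P W"
proof -
  have fin: "finite P" and WP: "W \<subseteq> Pow P" and ne: "W \<noteq> {}"
    and up: "\<And>X Y. X \<in> W \<Longrightarrow> X \<subseteq> Y \<Longrightarrow> Y \<subseteq> P \<Longrightarrow> Y \<in> W"
    using game unfolding simple_game_def by blast+
  have finW: "finite W" using WP fin by (auto intro: finite_subset)
  have finX: "finite X" if "X \<subseteq> P" for X using that fin by (rule finite_subset)
  obtain Z where "Z \<subseteq> P" "Z \<notin> W" using game unfolding simple_game_def by blast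
  then have empty: "{} \<in> losing P W" using up[of "{}" Z] by (auto simp: losing_def)
  define w' where "w' a = max (w a) 0" for a
  \<comment> \<open>The least weight of a winning coalition serves as quota. It is positive because
    the empty coalition is losing and has weight 0.\<close>
  define q where "q = Min (sum w' ` W)"
  have strict: "sum w' Y < sum w' X" if "X \<in> W" "Y \<in> losing P W" for X Y
  proof -
    let ?Y = "{a \<in> Y. 0 \<le> w a}"
    have "?Y \<in> losing P W"
      using that(2) up[of ?Y Y] by (auto simp: losing_def)
    then have "sum w ?Y < sum w X" using sep that(1) by blast
    also have "\<dots> \<le> sum w' X" by (intro sum_mono) (simp add: w'_def)
    also have "sum w ?Y = sum w' Y"
      using that(2) finX
      by (intro sum.mono_neutral_cong_left) (auto simp: losing_def w'_def)
    finally show ?thesis .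
  qed
  have low: "sum w' Y < q" if "Y \<in> losing P W" for Y
    using strict[OF _ that] finW ne by (simp add: q_def)
  have "q \<le> sum w' X" if "X \<in> W" for X
    using that finW by (simp add: q_def)
  then have "\<forall>X. X \<subseteq> P \<longrightarrow> (X \<in> W \<longleftrightarrow> q \<le> sum w' X)"
    using low by (auto simp: losing_def not_le[symmetric])
  moreover have "0 < q" using low[OF empty] by simp
  moreover have "\<forall>a\<in>P. 0 \<le> w' a" by (simp add: w'_def)
  ultimately show ?thesis
    unfolding weighted_majority_game_def by (intro exI conjI)
qed

section \<open>From a linear dependence to a trading transform\<close>

lemma length_filter_concat_replicate:
  "length (filter p (concat (map (\<lambda>u. replicate (m u) (g u)) us)))
    = (\<Sum>u\<leftarrow>us. if p (g u) then m u else 0)"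
  by (induction us) auto

text \<open>At the coordinate of a player, the integer dependence computes how many more of the
  chosen winning than losing coalitions contain that player. Its vanishing is the trading condition,
  and the sum of its coefficients is the length.\<close>

lemma not_weighted_imp_small_transform:
  assumes game: "simple_game P W" and n: "card P = n"
    and not_weighted: "\<not> weighted_majority_game P W"
  obtains Xs Ys where "trading_transform P Xs Ys" "set Xs \<subseteq> W" "set Ys \<subseteq> losing P W"
    "real (length Xs) \<le> (real n + 1) * sqrt (real n) ^ n"
proof -
  have fin: "finite P" and WP: "W \<subseteq> Pow P"
    using game unfolding simple_game_def by blast+
  obtain f where f: "bij_betw f {..<n} P"
    using ex_bij_betw_nat_finite[OF fin] n by (auto simp: lessThan_atLeast0)
  define \<delta> :: "'a set \<times> 'a set \<Rightarrow> nat \<Rightarrow> real"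
    where "\<delta> = (\<lambda>(X, Y) i. of_bool (f i \<in> X) - of_bool (f i \<in> Y))"
  define S where "S = \<delta> ` (W \<times> losing P W)"
  have finS: "finite S"
    using fin WP by (auto simp: S_def losing_def intro: finite_subset)
  have "\<nexists>w. \<forall>u\<in>S. 0 < (\<Sum>i<n. w i * u i)"
  proof
    assume "\<exists>w. \<forall>u\<in>S. 0 < (\<Sum>i<n. w i * u i)"
    then obtain w where w: "\<And>u. u \<in> S \<Longrightarrow> 0 < (\<Sum>i<n. w i * u i)" by blast
    \<comment> \<open>The functional is carried back to the players along the numbering
      \<open>f\<close>; being positive on \<open>S\<close>, it would separate winning from losing
      coalitions.\<close>
    define w' where "w' = w \<circ> inv_into {..<n} f"
    have w': "(\<Sum>i<n. w i * of_bool (f i \<in> X)) = sum w' X" if "X \<subseteq> P" for X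
    proof -
      have "(\<Sum>i<n. w i * of_bool (f i \<in> X)) = (\<Sum>i<n. w' (f i) * of_bool (f i \<in> X))"
        using f by (intro sum.cong) (auto simp: w'_def bij_betw_def)
      also have "\<dots> = (\<Sum>a\<in>P. w' a * of_bool (a \<in> X))"
        using f by (rule sum.reindex_bij_betw)
      also have "\<dots> = sum w' X"
        using fin that by (intro sum.mono_neutral_cong_right) auto
      finally show ?thesis .
    qed
    have "sum w' Y < sum w' X" if "X \<in> W" "Y \<in> losing P W" for X Y
    proof -
      have "\<delta> (X, Y) \<in> S" using that by (simp add: S_def)
      then have "0 < (\<Sum>i<n. w i * of_bool (f i \<in> X)) - (\<Sum>i<n. w i * of_bool (f i \<in> Y))"
        using w by (fastforce simp: \<delta>_def right_diff_distrib sum_subtractf)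
      then show ?thesis
        using that WP by (subst (asm) (1 2) w') (auto simp: losing_def)
    qed
    with game not_weighted separated_imp_weighted show False by blast
  qed
  then obtain z where z: "z \<in> pos_cone S" "\<And>i. i < n \<Longrightarrow> z i = 0"
    using gordan[OF finS, of n] by blast
  obtain R m where R: "R \<subseteq> S" "card R \<le> n + 1" "\<exists>u\<in>R. 0 < m u"
    and m: "\<And>u. u \<in> R \<Longrightarrow> real (m u) \<le> sqrt (real n) ^ n"
    and dep: "\<And>i. i < n \<Longrightarrow> (\<Sum>u\<in>R. real (m u) * u i) = 0"
  proof (rule small_integer_dependence[OF finS _ z])
    show "u i \<in> {-1, 0, 1}" if "u \<in> S" for u i
      using that by (auto simp: S_def \<delta>_def)
  qed auto
  obtain us where us: "set us = R" "distinct us"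
    using finite_distinct_list R(1) finS finite_subset by metis
  \<comment> \<open>Different pairs of coalitions may have the same difference vector, so one pair
    is chosen for each vector.\<close>
  define p where "p = inv_into (W \<times> losing P W) \<delta>"
  have p: "fst (p u) \<in> W" "snd (p u) \<in> losing P W" "\<delta> (p u) = u" if "u \<in> R" for u
    using that R(1) inv_into_into[of u \<delta> "W \<times> losing P W"] f_inv_into_f[of u \<delta> "W \<times> losing P W"]
    by (auto simp: S_def p_def mem_Times_iff)
  define Xs Ys where "Xs = concat (map (\<lambda>u. replicate (m u) (fst (p u))) us)"
    and "Ys = concat (map (\<lambda>u. replicate (m u) (snd (p u))) us)"
  have len: "length Xs = (\<Sum>u\<in>R. m u)" "length Ys = (\<Sum>u\<in>R. m u)"
    using us by (auto simp: Xs_def Ys_def length_concat comp_def sum_list_distinct_conv_sum_set)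
  have sub: "set Xs \<subseteq> W" "set Ys \<subseteq> losing P W"
    using p(1,2) us by (auto simp: Xs_def Ys_def)
  have "finite R" using us by auto
  then have "0 < (\<Sum>u\<in>R. m u)" using R(3) by (metis sum_pos2 zero_le)
  then have ne: "Xs \<noteq> []" using len by auto
  have "length (filter ((\<in>) a) Xs) = length (filter ((\<in>) a) Ys)" if "a \<in> P" for a
  proof -
    have "a \<in> f ` {..<n}" using f that by (simp add: bij_betw_def)
    then obtain i where i: "i < n" "a = f i" by blast
    have "real (length (filter ((\<in>) a) Xs)) - real (length (filter ((\<in>) a) Ys))
      = (\<Sum>u\<in>R. real (m u) * \<delta> (p u) i)"
      unfolding Xs_def Ys_def length_filter_concat_replicate
      using us by (auto simp: sum_list_distinct_conv_sum_set \<delta>_def i case_prod_unfold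
          simp flip: sum_subtractf intro!: sum.cong)
    also have "\<dots> = 0"
      using dep[OF i(1)] p(3) by simp
    finally show ?thesis by simp
  qed
  then have "trading_transform P Xs Ys"
    unfolding trading_transform_def
    using ne len sub WP by (auto simp: length_filter_conv_card losing_def)
  moreover have "real (length Xs) \<le> (real n + 1) * sqrt (real n) ^ n"
  proof -
    have "real (length Xs) \<le> real (card R) * sqrt (real n) ^ n"
      unfolding len of_nat_sum using m by (rule sum_bounded_above)
    also have "\<dots> \<le> real (n + 1) * sqrt (real n) ^ n"
      using R(2) by (intro mult_right_mono) auto
    finally show ?thesis by (simp add: algebra_simps)
  qed
  ultimately show thesis using sub by (intro that)
qed

theorem theorem4:
  fixes P :: "'a set" and W :: "'a set set" and n :: nat and N :: real
  assumes "simple_game P W"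
    and "card P = n"
    and "N = (real n + 1) * 2 powr (1 / 2 * real n * log 2 (real n))"
  shows "weighted_majority_game P W \<longleftrightarrow> trade_robust N P W"
proof
  have fin: "finite P" using assms(1) by (simp add: simple_game_def)
  show "trade_robust N P W" if "weighted_majority_game P W"
    using fin that by (rule weighted_imp_trade_robust)
  show "weighted_majority_game P W" if "trade_robust N P W"
  proof (rule ccontr)
    assume "\<not> weighted_majority_game P W"
    then obtain Xs Ys where *: "trading_transform P Xs Ys" "set Xs \<subseteq> W" "set Ys \<subseteq> losing P W"
      "real (length Xs) \<le> (real n + 1) * sqrt (real n) ^ n"
      using not_weighted_imp_small_transform[OF assms(1,2)] by blast
    \<comment> \<open>On no players, a nonempty \<open>W\<close> would be all of
      \<open>Pow P\<close>. Thus \<open>n\<close> is positive, and the logarithm in the bound is a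
      genuine one.\<close>
    have "P \<noteq> {}" using assms(1) by (auto simp: simple_game_def)
    then have n: "0 < real n" using fin assms(2) by (auto simp: card_gt_0_iff)
    \<comment> \<open>The bound \<open>N\<close> is the Hadamard bound times \<open>n + 1\<close>,
      since \<open>2 powr (n / 2 * log 2 n)\<close> equals \<open>n powr (n / 2)\<close>.\<close>
    have "2 powr (1 / 2 * real n * log 2 (real n)) = (2 powr log 2 (real n)) powr (1 / 2 * real n)"
      by (simp add: powr_powr mult.commute)
    also have "\<dots> = (real n powr (1 / 2)) powr real n"
      using n by (simp add: powr_powr)
    also have "\<dots> = sqrt (real n) ^ n"
      using n by (simp add: powr_half_sqrt powr_realpow)
    finally have "N = (real n + 1) * sqrt (real n) ^ n"
      using assms(3) by simp
    with * that show False by (auto simp: trade_robust_def)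
  qed
qed

end
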